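(* Let $\omega_1 = 1$, $\omega_2=\sqrt{2}$, $\omega_3=\sqrt{3}$, $a=\frac{\omega_1+\omega_2+\omega_3}{2}$, and let $$\Lambda_1=\{a+n_1\omega_1+n_2\omega_2+n_3\omega_3 : n_1,n_2,n_3\in\mathbb{Z}_{+}\},\qquad \Lambda=\Lambda_1\cup(-\Lambda_1).$$ Let $w$ be a complex number. Then there exists a non-zero function $f\in\mathcal{S}(\mathbb{R})$ with compact support such that $$\sum_{\lambda\in\Lambda}f(x-\lambda)=w\quad\text{for every }x\in\mathbb{R}.$$
   Context: $\mathbb{Z}_+$ denotes the set of nonnegative integers. $\mathcal{S}(\mathbb{R})$ is the Schwartz space of (complex-valued) functions on $\mathbb{R}$. The set $\Lambda$ is discrete (locally finite), so for compactly supported $f$ the sum has only finitely many nonzero terms for each $x$. *)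

theory Defs
  imports "HOL-Analysis.Analysis"
begin

definition nth_deriv :: "nat \<Rightarrow> (real \<Rightarrow> complex) \<Rightarrow> real \<Rightarrow> complex" where
  "nth_deriv n f = ((\<lambda>g x. vector_derivative g (at x)) ^^ n) f"

text \<open>\<^const>\<open>vector_derivative\<close> is total, so smoothness has to be demanded explicitly.\<close>

definition schwartz_space :: "(real \<Rightarrow> complex) set" where
  "schwartz_space = {f.
     (\<forall>n x. nth_deriv n f differentiable (at x)) \<and>
     (\<forall>m n. bounded (range (\<lambda>x. x ^ m *\<^sub>R nth_deriv n f x)))}"

definition compactly_supported :: "(real \<Rightarrow> complex) \<Rightarrow> bool" where
  "compactly_supported f \<longleftrightarrow> compact (closure {x. f x \<noteq> 0})"

definition \<omega>1 :: real where "\<omega>1 = 1"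
definition \<omega>2 :: real where "\<omega>2 = sqrt 2"
definition \<omega>3 :: real where "\<omega>3 = sqrt 3"

definition shift_a :: real where "shift_a = (\<omega>1 + \<omega>2 + \<omega>3) / 2"

definition Lambda1 :: "real set" where
  "Lambda1 = {shift_a + real n1 * \<omega>1 + real n2 * \<omega>2 + real n3 * \<omega>3 | n1 n2 n3 :: nat. True}"

definition Lambda :: "real set" where
  "Lambda = Lambda1 \<union> uminus ` Lambda1"

end

theory Submission
  imports
    Defs
    "HOL-Computational_Algebra.Polynomial"
    "HOL-Computational_Algebra.Primes"
begin

text \<open>
  Write \<open>D\<^sub>\<omega> g (x) = g (x + \<omega>/2) - g (x - \<omega>/2)\<close>. Convolution with the point masses at
  \<open>\<omega>/2 + n\<omega>\<close>, \<open>n \<ge> 0\<close>, inverts \<open>D\<^sub>\<omega>\<close> on functions vanishing near \<open>-\<infinity>\<close>. Hence, for \<open>H\<close>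
  smooth with \<open>H = 0\<close> near \<open>-\<infinity>\<close> and \<open>H = w\<close> near \<open>+\<infinity>\<close>, the function
  \<open>f = D\<^sub>1 D\<^sub>2 D\<^sub>3 H\<close> is smooth with compact support and its sum over \<open>\<Lambda>\<^sub>1\<close> is \<open>H\<close>. As \<open>f\<close> is also
  \<open>D\<^sub>1 D\<^sub>2 D\<^sub>3 (H - w)\<close>, reflecting and using that three (an odd number) of differences occur,
  its sum over \<open>-\<Lambda>\<^sub>1\<close> is \<open>w - H\<close>. The two sums add up to \<open>w\<close>, and \<open>f \<noteq> 0\<close> because \<open>H \<noteq> 0\<close>.
\<close>

section \<open>Smooth functions\<close>

text \<open>The derivatives are supplied as witnesses instead of through \<open>nth_deriv\<close>,
  so closure under sums, products and affine substitutions is an induction on the order.\<close>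

primrec times_differentiable :: "nat \<Rightarrow> (real \<Rightarrow> 'a::real_normed_vector) \<Rightarrow> bool" where
  "times_differentiable 0 f \<longleftrightarrow> True"
| "times_differentiable (Suc n) f \<longleftrightarrow>
     (\<exists>f'. (\<forall>x. (f has_vector_derivative f' x) (at x)) \<and> times_differentiable n f')"

definition smooth :: "(real \<Rightarrow> 'a::real_normed_vector) \<Rightarrow> bool" where
  "smooth f \<longleftrightarrow> (\<forall>n. times_differentiable n f)"

lemma times_differentiable_SucI:
  assumes "\<And>x. (f has_vector_derivative f' x) (at x)" "times_differentiable n f'"
  shows "times_differentiable (Suc n) f"
  using assms by (auto intro!: exI[of _ f'])

lemma times_differentiable_chain:
  assumes "\<And>n x. (F n has_vector_derivative F (Suc n) x) (at x)"
  shows "times_differentiable m (F k)"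
  using assms by (induction m arbitrary: k) auto

lemma times_differentiable_Suc_D:
  "times_differentiable (Suc n) f \<Longrightarrow> times_differentiable n f"
proof (induction n arbitrary: f)
  case (Suc n)
  then obtain f' where "\<And>x. (f has_vector_derivative f' x) (at x)"
    "times_differentiable (Suc n) f'" by auto
  then show ?case using Suc.IH by auto
qed simp

lemma times_differentiable_linear:
  assumes L: "bounded_linear L"
  shows "times_differentiable n f \<Longrightarrow> times_differentiable n (\<lambda>x. L (f x))"
proof (induction n arbitrary: f)
  case (Suc n)
  then obtain f' where f': "\<And>x. (f has_vector_derivative f' x) (at x)"
    "times_differentiable n f'" by auto
  have "times_differentiable n (\<lambda>x. L (f' x))" by (rule Suc.IH[OF f'(2)])
  with bounded_linear.has_vector_derivative[OF L f'(1)] show ?case by (rule times_differentiable_SucI)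
qed simp

lemma times_differentiable_add:
  "times_differentiable n f \<Longrightarrow> times_differentiable n g \<Longrightarrow> times_differentiable n (\<lambda>x. f x + g x)"
proof (induction n arbitrary: f g)
  case (Suc n)
  then obtain f' g' where f': "\<And>x. (f has_vector_derivative f' x) (at x)"
    "times_differentiable n f'" and g': "\<And>x. (g has_vector_derivative g' x) (at x)"
    "times_differentiable n g'" by auto
  have "times_differentiable n (\<lambda>x. f' x + g' x)" by (rule Suc.IH[OF f'(2) g'(2)])
  with has_vector_derivative_add[OF f'(1) g'(1)] show ?case by (rule times_differentiable_SucI)
qed simp

lemma times_differentiable_affine:
  "times_differentiable n f \<Longrightarrow> times_differentiable n (\<lambda>x. f (c * x + d))"
proof (induction n arbitrary: f)
  case (Suc n)
  then obtain f' where f': "\<And>x. (f has_vector_derivative f' x) (at x)"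
    "times_differentiable n f'" by auto
  have "((\<lambda>x. f (c * x + d)) has_vector_derivative c *\<^sub>R f' (c * x + d)) (at x)" for x
  proof -
    have "((\<lambda>x. c * x + d) has_vector_derivative c) (at x)"
      by (auto intro!: derivative_eq_intros)
    from vector_diff_chain_at[OF this f'(1)] show ?thesis by (simp add: o_def)
  qed
  moreover have "times_differentiable n (\<lambda>x. c *\<^sub>R f' (c * x + d))"
    by (intro times_differentiable_linear[OF bounded_linear_scaleR_right] Suc.IH f'(2))
  ultimately show ?case by (rule times_differentiable_SucI)
qed simp

lemma times_differentiable_mult:
  fixes f g :: "real \<Rightarrow> 'a::real_normed_algebra"
  shows "times_differentiable n f \<Longrightarrow> times_differentiable n g \<Longrightarrow> times_differentiable n (\<lambda>x. f x * g x)"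
proof (induction n arbitrary: f g)
  case (Suc n)
  then obtain f' g' where f': "\<And>x. (f has_vector_derivative f' x) (at x)"
    "times_differentiable n f'" and g': "\<And>x. (g has_vector_derivative g' x) (at x)"
    "times_differentiable n g'" by auto
  have "times_differentiable n (\<lambda>x. f x * g' x + f' x * g x)"
    using Suc.prems[THEN times_differentiable_Suc_D] f'(2) g'(2)
    by (intro times_differentiable_add Suc.IH)
  with has_vector_derivative_mult[OF f'(1) g'(1)] show ?case by (rule times_differentiable_SucI)
qed simp

lemma smooth_antiderivative:
  assumes "\<And>x. (f has_vector_derivative f' x) (at x)" "smooth f'"
  shows "smooth f"
  unfolding smooth_def
proof
  fix n show "times_differentiable n f"
    using assms by (cases n) (auto simp: smooth_def)
qed

lemma smooth_continuous:
  assumes "smooth f" shows "continuous_on UNIV f"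
proof -
  have "times_differentiable (Suc 0) f" using assms unfolding smooth_def by blast
  then show ?thesis
    by (auto intro!: continuous_at_imp_continuous_on intro: has_vector_derivative_continuous)
qed

section \<open>Iterated derivatives and the Schwartz space\<close>

lemma nth_deriv_0: "nth_deriv 0 f = f"
  by (simp add: nth_deriv_def)

lemma nth_deriv_Suc: "nth_deriv (Suc n) f = (\<lambda>x. vector_derivative (nth_deriv n f) (at x))"
  by (simp add: nth_deriv_def)

lemma nth_deriv_Suc_shift: "nth_deriv (Suc n) f = nth_deriv n (\<lambda>x. vector_derivative f (at x))"
  by (simp add: nth_deriv_def funpow_Suc_right del: funpow.simps)

text \<open>Links the witnesses to \<open>nth_deriv\<close>: derivatives are unique, and peeling off
  the innermost one matches the recursion of \<open>times_differentiable\<close>.\<close>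

lemma times_differentiable_imp_differentiable:
  "times_differentiable (Suc n) f \<Longrightarrow> nth_deriv n f differentiable (at x)"
proof (induction n arbitrary: f)
  case 0
  then show ?case by (auto simp: nth_deriv_0 intro: differentiableI_vector)
next
  case (Suc n)
  then obtain f' where f': "\<And>x. (f has_vector_derivative f' x) (at x)"
    "times_differentiable (Suc n) f'" by auto
  have "(\<lambda>x. vector_derivative f (at x)) = f'"
    using f'(1) by (auto simp: vector_derivative_at)
  then show ?case using Suc.IH[OF f'(2)] by (simp add: nth_deriv_Suc_shift)
qed

lemma nth_deriv_eq_0_on_open:
  assumes "open S" "\<And>x. x \<in> S \<Longrightarrow> f x = 0" "x \<in> S"
  shows "nth_deriv n f x = 0"
  using assms(3)
proof (induction n arbitrary: x)
  case (Suc n)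
  have "((\<lambda>x. 0) has_vector_derivative 0) (at x)" by simp
  then have "(nth_deriv n f has_vector_derivative 0) (at x)"
    by (rule has_vector_derivative_transform_within_open[OF _ assms(1) Suc.prems])
       (simp add: Suc.IH)
  then show ?case by (simp add: nth_deriv_Suc vector_derivative_at)
qed (simp add: nth_deriv_0 assms(2))

text \<open>Every derivative vanishes outside \<open>{-R..R}\<close>, and on this compact interval
  its product with a power of \<open>x\<close> is continuous, hence bounded.\<close>

lemma smooth_vanishing_outside_ball:
  assumes f: "smooth f" and R: "\<And>x. \<bar>x\<bar> > R \<Longrightarrow> f x = 0"
  shows "f \<in> schwartz_space" and "compactly_supported f"
proof -
  have d: "nth_deriv n f differentiable (at x)" for n x
    using f by (auto simp only: smooth_def intro!: times_differentiable_imp_differentiable)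
  have "open {x::real. \<bar>x\<bar> > R}"
    by (intro open_Collect_less continuous_intros)
  then have z: "nth_deriv n f x = 0" if "\<bar>x\<bar> > R" for n x
    by (rule nth_deriv_eq_0_on_open) (use R that in auto)
  have "bounded (range (\<lambda>x. x ^ m *\<^sub>R nth_deriv n f x))" for m n
  proof -
    let ?g = "\<lambda>x. x ^ m *\<^sub>R nth_deriv n f x"
    have "continuous_on {-R..R} ?g"
      by (intro continuous_intros differentiable_imp_continuous_on)
         (auto simp: differentiable_on_def intro: differentiable_at_withinI d)
    then have "bounded (?g ` {-R..R})"
      by (intro compact_imp_bounded compact_continuous_image) auto
    moreover have "range ?g \<subseteq> insert 0 (?g ` {-R..R})"
    proof
      fix y assume "y \<in> range ?g"
      then obtain x where "y = ?g x" by auto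
      then show "y \<in> insert 0 (?g ` {-R..R})"
        using z[of x n] by (cases "\<bar>x\<bar> > R") (auto simp: abs_le_iff not_less)
    qed
    ultimately show ?thesis by (metis bounded_insert bounded_subset)
  qed
  with d show "f \<in> schwartz_space" by (auto simp: schwartz_space_def)
  have "{x. f x \<noteq> 0} \<subseteq> cball 0 R" using R by (auto simp: not_less[symmetric])
  then show "compactly_supported f"
    unfolding compactly_supported_def compact_closure by (rule bounded_subset[OF bounded_cball])
qed

section \<open>A smooth step function\<close>

lemma tendsto_poly_times_exp_minus:
  fixes p :: "real poly"
  shows "((\<lambda>y. poly p y * exp (- y)) \<longlongrightarrow> 0) at_top"
proof -
  have "((\<lambda>y. \<Sum>i\<le>degree p. coeff p i * (y ^ i / exp y)) \<longlongrightarrow> (\<Sum>i\<le>degree p. coeff p i * 0)) at_top"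
    by (intro tendsto_intros tendsto_power_div_exp_0)
  then show ?thesis
    by (simp add: poly_altdef exp_minus field_simps sum_distrib_left sum_divide_distrib)
qed

text \<open>For \<open>p = 1\<close> this is the classical flat function exp(-1/x), extended by 0.
  The polynomial factor in 1/x makes the family closed under differentiation.\<close>

definition flat_exp :: "real poly \<Rightarrow> real \<Rightarrow> real" where
  "flat_exp p x = (if x > 0 then poly p (inverse x) * exp (- inverse x) else 0)"

text \<open>With y = 1/x, d/dx is -y^2 d/dy, which sends p(y) exp(-y) to y^2 (p - p')(y)
  exp(-y).\<close>

definition flat_exp_step :: "real poly \<Rightarrow> real poly" where
  "flat_exp_step p = [:0, 0, 1:] * (p - pderiv p)"

lemma has_real_derivative_flat_exp:
  "(flat_exp p has_real_derivative flat_exp (flat_exp_step p) x) (at x)"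
proof (cases x "0::real" rule: linorder_cases)
  case less
  have "((\<lambda>x. 0) has_real_derivative 0) (at x)" by simp
  then have "(flat_exp p has_real_derivative 0) (at x)"
    by (rule has_field_derivative_transform_within_open[where S = "{..<0}"])
       (use less in \<open>auto simp: flat_exp_def\<close>)
  then show ?thesis using less by (simp add: flat_exp_def)
next
  case greater
  have "((\<lambda>x. poly p (inverse x) * exp (- inverse x)) has_real_derivative
      flat_exp (flat_exp_step p) x) (at x)"
    using greater
    by (auto intro!: derivative_eq_intros poly_DERIV DERIV_chain2[where f = "poly p"]
        simp: flat_exp_def flat_exp_step_def algebra_simps power2_eq_square)
  then show ?thesis
    by (rule has_field_derivative_transform_within_open[where S = "{0<..}"])
       (use greater in \<open>auto simp: flat_exp_def\<close>)
next
  case equal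
  have "((\<lambda>h. flat_exp p h / h) \<longlongrightarrow> 0) (at 0)"
  proof (rule filterlim_split_at)
    have "\<forall>\<^sub>F h in at_left 0. 0 = flat_exp p h / h"
      by (auto simp: eventually_at_filter flat_exp_def)
    then show "((\<lambda>h. flat_exp p h / h) \<longlongrightarrow> 0) (at_left 0)"
      by (rule Lim_transform_eventually[OF tendsto_const])
    \<comment> \<open>Dividing by \<open>h\<close> multiplies the polynomial by y = 1/h, hence
      \<open>pCons 0 p\<close>; exponential decay wins as y tends to infinity.\<close>
    have "((\<lambda>h. poly (pCons 0 p) (inverse h) * exp (- inverse h)) \<longlongrightarrow> 0) (at_right 0)"
      by (rule filterlim_compose[OF tendsto_poly_times_exp_minus filterlim_inverse_at_top_right])
    moreover have "\<forall>\<^sub>F h in at_right 0.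
        poly (pCons 0 p) (inverse h) * exp (- inverse h) = flat_exp p h / h"
      by (auto simp: eventually_at_filter flat_exp_def field_simps)
    ultimately show "((\<lambda>h. flat_exp p h / h) \<longlongrightarrow> 0) (at_right 0)"
      by (rule Lim_transform_eventually)
  qed
  then show ?thesis using equal by (simp add: has_field_derivative_iff flat_exp_def)
qed

lemma times_differentiable_flat_exp: "times_differentiable n (flat_exp p)"
proof -
  \<comment> \<open>The iterates of \<open>flat_exp_step\<close> list all successive derivatives
    explicitly.\<close>
  have "times_differentiable n ((\<lambda>k. flat_exp ((flat_exp_step ^^ k) p)) 0)"
    by (rule times_differentiable_chain)
       (simp add: has_real_derivative_iff_has_vector_derivative[symmetric]
          has_real_derivative_flat_exp)
  then show ?thesis by simp
qed

section \<open>The bump function and its integral\<close>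

definition bump :: "real \<Rightarrow> real" where
  "bump x = flat_exp 1 x * flat_exp 1 (1 - x)"

lemma smooth_bump: "smooth bump"
  unfolding smooth_def
proof
  fix n
  have "times_differentiable n (\<lambda>x. flat_exp 1 x * flat_exp 1 ((-1) * x + 1))"
    by (intro times_differentiable_mult times_differentiable_affine times_differentiable_flat_exp)
  moreover have "bump = (\<lambda>x. flat_exp 1 x * flat_exp 1 ((-1) * x + 1))"
    by (simp add: bump_def fun_eq_iff)
  ultimately show "times_differentiable n bump" by simp
qed

lemma bump_nonneg: "bump x \<ge> 0"
  and bump_pos: "0 < x \<Longrightarrow> x < 1 \<Longrightarrow> bump x > 0"
  and bump_eq_0: "x \<le> 0 \<or> x \<ge> 1 \<Longrightarrow> bump x = 0"
  by (auto simp: bump_def flat_exp_def)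

text \<open>The lower limit -1 lies strictly to the left of the support of \<open>bump\<close>, so
  each \<open>x \<ge> 0\<close>, including 0, is interior to \<open>{-1..x+1}\<close> when the
  integral is differentiated.\<close>

definition bump_int :: "real \<Rightarrow> real" where
  "bump_int x = integral {-1..x} bump"

lemma bump_integrable: "bump integrable_on {a..b}"
  using smooth_continuous[OF smooth_bump]
  by (blast intro: integrable_continuous_interval continuous_on_subset)

lemma bump_int_eq_0: "x \<le> 0 \<Longrightarrow> bump_int x = 0"
  unfolding bump_int_def
  by (rule integral_unique, rule has_integral_is_0) (auto intro: bump_eq_0)

lemma bump_int_eq: "x \<ge> 1 \<Longrightarrow> bump_int x = bump_int 1"
proof -
  assume "x \<ge> 1"
  then have "integral {-1..1} bump + integral {1..x} bump = integral {-1..x} bump"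
    by (intro Henstock_Kurzweil_Integration.integral_combine bump_integrable) auto
  moreover have "integral {1..x} bump = 0"
    by (rule integral_unique, rule has_integral_is_0) (auto intro: bump_eq_0)
  ultimately show ?thesis by (simp add: bump_int_def)
qed

text \<open>A continuous nonnegative function with integral 0 vanishes on the interval, but
  \<open>bump (1/2)\<close> is positive.\<close>

lemma bump_int_pos: "bump_int 1 > 0"
proof -
  have "continuous_on {-1..1} bump"
    using smooth_continuous[OF smooth_bump] continuous_on_subset by blast
  then have "integral {-1..1} bump = 0 \<longleftrightarrow> (\<forall>x\<in>{-1..1}. bump x = 0)"
    by (rule integral_eq_0_iff) (auto intro: bump_nonneg)
  moreover have "bump (1/2) \<noteq> 0" using bump_pos[of "1/2"] by simp
  ultimately have "integral {-1..1} bump \<noteq> 0" by force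
  moreover have "integral {-1..1} bump \<ge> 0"
    by (rule integral_nonneg[OF bump_integrable]) (rule bump_nonneg)
  ultimately show ?thesis by (simp add: bump_int_def)
qed

lemma has_vector_derivative_bump_int: "(bump_int has_vector_derivative bump x) (at x)"
proof (cases "x < 0")
  case True
  have "((\<lambda>x. 0) has_vector_derivative 0) (at x)" by simp
  then have "(bump_int has_vector_derivative 0) (at x)"
    by (rule has_vector_derivative_transform_within_open[where S = "{..<0}"])
       (use True in \<open>auto simp: bump_int_eq_0\<close>)
  then show ?thesis using True by (simp add: bump_eq_0)
next
  case False
  have "continuous_on {-1..x+1} bump"
    using smooth_continuous[OF smooth_bump] continuous_on_subset by blast
  then have "((\<lambda>u. integral {-1..u} bump) has_vector_derivative bump x) (at x within {-1..x+1})"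
    by (rule integral_has_vector_derivative) (use False in auto)
  moreover have "at x within {-1..x+1} = at x"
    by (rule at_within_interior) (use False in simp)
  ultimately show ?thesis by (simp add: bump_int_def[abs_def])
qed

text \<open>The point \<open>x0\<close> will later show that the constructed function is non-zero.
  For \<open>w = 0\<close> a rescaled \<open>bump_int\<close> would vanish identically, so
  \<open>bump\<close> itself serves as a transition from 0 to 0.\<close>

lemma exists_smooth_transition:
  fixes w :: complex
  obtains H :: "real \<Rightarrow> complex" and x0 where "smooth H" "H x0 \<noteq> 0"
    "\<And>x. x \<le> 0 \<Longrightarrow> H x = 0" "\<And>x. x \<ge> 1 \<Longrightarrow> H x = w"
proof (cases "w = 0")
  case True
  show ?thesis
  proof (rule that)
    show "smooth (\<lambda>x. complex_of_real (bump x))"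
      using smooth_bump times_differentiable_linear[OF bounded_linear_of_real]
      by (auto simp: smooth_def)
    show "complex_of_real (bump (1/2)) \<noteq> 0" using bump_pos[of "1/2"] by simp
  qed (use True in \<open>auto simp: bump_eq_0\<close>)
next
  case False
  let ?H = "\<lambda>x. (w / complex_of_real (bump_int 1)) * complex_of_real (bump_int x)"
  have "smooth bump_int"
    by (rule smooth_antiderivative[OF has_vector_derivative_bump_int smooth_bump])
  then have "smooth ?H"
    using times_differentiable_linear[OF bounded_linear_compose[OF bounded_linear_mult_right
        bounded_linear_of_real]]
    unfolding smooth_def by blast
  moreover have "?H 1 \<noteq> 0" using False bump_int_pos by simp
  moreover have "?H x = 0" if "x \<le> 0" for x using bump_int_eq_0[OF that] by simp
  moreover have "?H x = w" if "x \<ge> 1" for x using bump_int_eq[OF that] bump_int_pos by simp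
  ultimately show ?thesis by (rule that)
qed

section \<open>Central differences\<close>

text \<open>The symmetric form makes reflection cost only a sign, and the half steps of the three
  differences add up to \<open>shift_a\<close>.\<close>

definition central_diff :: "real \<Rightarrow> (real \<Rightarrow> complex) \<Rightarrow> real \<Rightarrow> complex" where
  "central_diff \<omega> g x = g (x + \<omega> / 2) - g (x - \<omega> / 2)"

lemma smooth_central_diff:
  assumes "smooth g" shows "smooth (central_diff \<omega> g)"
  unfolding smooth_def
proof
  fix n
  have g: "times_differentiable n g" using assms by (simp add: smooth_def)
  have "times_differentiable n (\<lambda>x. g (1 * x + \<omega> / 2) + - g (1 * x + (- \<omega> / 2)))"
    by (intro times_differentiable_add times_differentiable_affine[OF g]
        times_differentiable_linear[OF bounded_linear_minus[OF bounded_linear_ident]])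
  then show "times_differentiable n (central_diff \<omega> g)"
    by (simp add: central_diff_def[abs_def])
qed

lemma central_diff_eq_0_left:
  assumes "\<And>y. y \<le> d \<Longrightarrow> g y = 0" "\<omega> \<ge> 0" "y \<le> d - \<omega> / 2"
  shows "central_diff \<omega> g y = 0"
  using assms(2,3) by (simp add: central_diff_def assms(1))

lemma central_diff_minus_const: "central_diff \<omega> (\<lambda>y. g y - c) = central_diff \<omega> g"
  by (simp add: central_diff_def fun_eq_iff)

lemma central_diff_uminus: "central_diff \<omega> (\<lambda>y. - g y) = (\<lambda>y. - central_diff \<omega> g y)"
  by (simp add: central_diff_def fun_eq_iff)

lemma central_diff_reflect: "central_diff \<omega> (\<lambda>y. g (- y)) = (\<lambda>y. - central_diff \<omega> g (- y))"
  by (simp add: central_diff_def fun_eq_iff)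

text \<open>The sum telescopes, and the second hypothesis puts the far end where \<open>g\<close>
  vanishes. This is the finite form of inverting the difference operator.\<close>

lemma sum_central_diff:
  assumes "\<And>y. y \<le> d \<Longrightarrow> g y = 0" "z - real N * \<omega> \<le> d"
  shows "(\<Sum>i<N. central_diff \<omega> g (z - \<omega> / 2 - real i * \<omega>)) = g z"
proof -
  have "(\<Sum>i<N. central_diff \<omega> g (z - \<omega> / 2 - real i * \<omega>))
      = (\<Sum>i<N. g (z - real i * \<omega>) - g (z - real (Suc i) * \<omega>))"
    by (rule sum.cong) (auto simp: central_diff_def algebra_simps)
  also have "\<dots> = g z - g (z - real N * \<omega>)"
    using sum_lessThan_telescope'[of "\<lambda>i. g (z - real i * \<omega>)" N] by simp
  also have "\<dots> = g z" using assms by simp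
  finally show ?thesis .
qed

definition triple_diff :: "(real \<Rightarrow> complex) \<Rightarrow> real \<Rightarrow> complex" where
  "triple_diff H = central_diff \<omega>1 (central_diff \<omega>2 (central_diff \<omega>3 H))"

lemma omega_ge_1: "\<omega>1 \<ge> 1" "\<omega>2 \<ge> 1" "\<omega>3 \<ge> 1"
  by (simp_all add: \<omega>1_def \<omega>2_def \<omega>3_def)

lemma triple_diff_eq_0_left:
  assumes "\<And>y. y \<le> d \<Longrightarrow> H y = 0" "y \<le> d - shift_a"
  shows "triple_diff H y = 0"
  unfolding triple_diff_def
proof (rule central_diff_eq_0_left)
  show "central_diff \<omega>2 (central_diff \<omega>3 H) y = 0" if "y \<le> d - \<omega>3 / 2 - \<omega>2 / 2" for y
    using that omega_ge_1
    by (intro central_diff_eq_0_left[of "d - \<omega>3 / 2"] central_diff_eq_0_left[of d] assms(1)) auto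
qed (use assms(2) omega_ge_1 in \<open>auto simp: shift_a_def field_simps\<close>)

text \<open>The innermost difference kills the constant \<open>w\<close>, and each of the three
  differences contributes a factor -1 under reflection.\<close>

lemma triple_diff_reflect: "triple_diff (\<lambda>y. H (- y) - w) y = - triple_diff H (- y)"
  by (simp add: triple_diff_def central_diff_minus_const central_diff_reflect central_diff_uminus)

section \<open>Summation over \<open>\<Lambda>\<close>\<close>

text \<open>For non-zero \<open>x\<close> and \<open>y\<close> the multiplicity of \<open>p\<close>
  would be even on the left and odd on the right.\<close>

lemma prime_times_square_eq_imp_0:
  fixes x y a b p :: int
  assumes p: "prime p" "\<not> p dvd a" "\<not> p dvd b" and eq: "a * x\<^sup>2 = p * b * y\<^sup>2"
  shows "x = 0 \<and> y = 0"
proof (rule ccontr)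
  assume n: "\<not> (x = 0 \<and> y = 0)"
  have nz: "a \<noteq> 0" "b \<noteq> 0" "p \<noteq> 0" using p by auto
  with n eq have xy: "x \<noteq> 0" "y \<noteq> 0" by auto
  have pe: "prime_elem p" using p(1) by (rule prime_imp_prime_elem)
  have "multiplicity p (a * x\<^sup>2) = 2 * multiplicity p x"
    using nz xy p pe
    by (simp add: prime_elem_multiplicity_mult_distrib prime_elem_multiplicity_power_distrib
        not_dvd_imp_multiplicity_0)
  moreover have "multiplicity p (p * b * y\<^sup>2) = Suc (2 * multiplicity p y)"
    using nz xy p pe
    by (simp add: prime_elem_multiplicity_mult_distrib prime_elem_multiplicity_power_distrib
        not_dvd_imp_multiplicity_0)
  ultimately have "2 * multiplicity p x = Suc (2 * multiplicity p y)" using eq by simp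
  then show False by presburger
qed

text \<open>Isolating sqrt 3 and squaring leaves only sqrt 2; a second squaring gives an integer
  equation that forces \<open>p * q = 0\<close>. Either case leaves two squares whose ratio is
  excluded by the prime 3.\<close>

lemma omega_independent:
  fixes p q r :: int
  assumes "real_of_int p * \<omega>1 + real_of_int q * \<omega>2 + real_of_int r * \<omega>3 = 0"
  shows "p = 0 \<and> q = 0 \<and> r = 0"
proof -
  have e: "real_of_int p + real_of_int q * sqrt 2 = - (real_of_int r * sqrt 3)"
    using assms by (simp add: \<omega>1_def \<omega>2_def \<omega>3_def)
  then have "(real_of_int p + real_of_int q * sqrt 2)\<^sup>2 = (real_of_int r * sqrt 3)\<^sup>2" by simp
  then have "real_of_int (3 * r\<^sup>2 - p\<^sup>2 - 2 * q\<^sup>2) = real_of_int (2 * p * q) * sqrt 2"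
    by (simp add: power2_sum power_mult_distrib)
  then have "(real_of_int (3 * r\<^sup>2 - p\<^sup>2 - 2 * q\<^sup>2))\<^sup>2 = (real_of_int (2 * p * q))\<^sup>2 * 2"
    by (simp only: power_mult_distrib) simp
  then have "real_of_int ((3 * r\<^sup>2 - p\<^sup>2 - 2 * q\<^sup>2)\<^sup>2) = real_of_int ((2 * p * q)\<^sup>2 * 2)"
    by (simp only: of_int_power of_int_mult of_int_numeral)
  \<comment> \<open>The factors 1 bring the equation into the shape of the valuation lemma for the
    prime 2.\<close>
  then have "1 * (3 * r\<^sup>2 - p\<^sup>2 - 2 * q\<^sup>2)\<^sup>2 = 2 * 1 * (2 * p * q)\<^sup>2"
    unfolding of_int_eq_iff by simp
  from prime_times_square_eq_imp_0[OF _ _ _ this]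
  have s: "3 * r\<^sup>2 - p\<^sup>2 - 2 * q\<^sup>2 = 0" and "p = 0 \<or> q = 0" by auto
  from this(2) show ?thesis
  proof
    assume "p = 0"
    \<comment> \<open>Here \<open>s\<close> reads 2 q^2 = 3 r^2; in the other case it reads p^2 = 3
      r^2.\<close>
    with s prime_times_square_eq_imp_0[of 3 2 1 q r] show ?thesis by auto
  next
    assume "q = 0"
    with s prime_times_square_eq_imp_0[of 3 1 1 p r] show ?thesis by auto
  qed
qed

section \<open>Parametrisation of \<open>Lambda1\<close> and the sums\<close>

definition lattice_point :: "nat \<times> nat \<times> nat \<Rightarrow> real" where
  "lattice_point = (\<lambda>(i, j, k). shift_a + real i * \<omega>1 + real j * \<omega>2 + real k * \<omega>3)"

text \<open>A sum over the set \<open>Lambda1\<close> counts each point once; injectivity lets it be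
  computed as a sum over triples.\<close>

lemma inj_lattice_point: "inj lattice_point"
proof (rule injI)
  fix s t assume eq: "lattice_point s = lattice_point t"
  obtain i j k where s: "s = (i, j, k)" by (cases s)
  obtain i' j' k' where t: "t = (i', j', k')" by (cases t)
  have "real_of_int (int i - int i') * \<omega>1 + real_of_int (int j - int j') * \<omega>2
      + real_of_int (int k - int k') * \<omega>3 = 0"
    using eq by (simp add: lattice_point_def s t algebra_simps)
  from omega_independent[OF this] show "s = t" by (simp add: s t)
qed

lemma Lambda1_eq: "Lambda1 = range lattice_point"
  by (simp add: set_eq_iff Lambda1_def lattice_point_def image_def split_paired_Ex del: add_left_cancel)

lemma Lambda1_pos: "l \<in> Lambda1 \<Longrightarrow> l > 0"
  using omega_ge_1 by (auto simp: Lambda1_def shift_a_def intro!: add_pos_nonneg)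

text \<open>Only triples in a finite box contribute, and there the sum telescopes in one index after
  another.\<close>

lemma has_sum_triple_diff:
  assumes H: "\<And>y. y \<le> d \<Longrightarrow> H y = 0"
  shows "((\<lambda>l. triple_diff H (x - l)) has_sum H x) Lambda1"
proof -
  \<comment> \<open>As each period is at least 1, \<open>N\<close> steps of any one of them lead
    from \<open>x\<close> to a point at most \<open>d\<close>.\<close>
  obtain N :: nat where N: "real N \<ge> x - d" using real_arch_simple by blast
  have Nw: "real N * \<omega> \<ge> x - d" if "\<omega> \<ge> 1" for \<omega>
    using N that mult_left_mono[of 1 \<omega> "real N"] by simp
  define B where "B = {..<N} \<times> {..<N} \<times> {..<N}"
  have D3: "central_diff \<omega>3 H y = 0" if "y \<le> d - \<omega>3 / 2" for y
    using that omega_ge_1 by (intro central_diff_eq_0_left[of d] H) auto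
  have D2: "central_diff \<omega>2 (central_diff \<omega>3 H) y = 0" if "y \<le> d - \<omega>3 / 2 - \<omega>2 / 2" for y
    using that omega_ge_1 by (intro central_diff_eq_0_left[of "d - \<omega>3 / 2"] D3) auto
  have nn: "0 \<le> real i * \<omega>1" "0 \<le> real i * \<omega>2" "0 \<le> real i * \<omega>3" for i
    using omega_ge_1 by auto
  \<comment> \<open>The index \<open>i\<close> of \<open>\<omega>1\<close> must be summed first,
    because \<open>\<omega>1\<close> belongs to the outermost difference.\<close>
  have "(\<Sum>t\<in>B. triple_diff H (x - lattice_point t)) =
      (\<Sum>k<N. \<Sum>j<N. \<Sum>i<N. triple_diff H (x - lattice_point (i, j, k)))"
  proof -
    have "(\<Sum>t\<in>B. triple_diff H (x - lattice_point t)) =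
      (\<Sum>i<N. \<Sum>j<N. \<Sum>k<N. triple_diff H (x - lattice_point (i, j, k)))"
      by (simp add: B_def sum.cartesian_product split_def)
    also have "\<dots> = (\<Sum>i<N. \<Sum>k<N. \<Sum>j<N. triple_diff H (x - lattice_point (i, j, k)))"
      by (rule sum.cong[OF refl], rule sum.swap)
    also have "\<dots> = (\<Sum>k<N. \<Sum>i<N. \<Sum>j<N. triple_diff H (x - lattice_point (i, j, k)))"
      by (rule sum.swap)
    also have "\<dots> = (\<Sum>k<N. \<Sum>j<N. \<Sum>i<N. triple_diff H (x - lattice_point (i, j, k)))"
      by (rule sum.cong[OF refl], rule sum.swap)
    finally show ?thesis .
  qed
  also have "\<dots> = (\<Sum>k<N. \<Sum>j<N. central_diff \<omega>2 (central_diff \<omega>3 H)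
      (x - \<omega>3 / 2 - real k * \<omega>3 - \<omega>2 / 2 - real j * \<omega>2))"
  proof (intro sum.cong refl)
    fix k j
    let ?z = "x - \<omega>3 / 2 - real k * \<omega>3 - \<omega>2 / 2 - real j * \<omega>2"
    \<comment> \<open>The half periods in the arguments come from splitting
      \<open>shift_a\<close>.\<close>
    have "(\<Sum>i<N. triple_diff H (x - lattice_point (i, j, k))) =
        (\<Sum>i<N. central_diff \<omega>1 (central_diff \<omega>2 (central_diff \<omega>3 H)) (?z - \<omega>1 / 2 - real i * \<omega>1))"
      unfolding triple_diff_def
      by (intro sum.cong refl arg_cong[where f = "central_diff _ _"])
         (simp add: lattice_point_def shift_a_def field_simps)
    also have "\<dots> = central_diff \<omega>2 (central_diff \<omega>3 H) ?z"
      by (rule sum_central_diff[where d = "d - \<omega>3 / 2 - \<omega>2 / 2"])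
         (use D2 nn[of k] nn[of j] Nw[OF omega_ge_1(1)] in auto)
    finally show "(\<Sum>i<N. triple_diff H (x - lattice_point (i, j, k))) =
        central_diff \<omega>2 (central_diff \<omega>3 H) ?z" .
  qed
  also have "\<dots> = (\<Sum>k<N. central_diff \<omega>3 H (x - \<omega>3 / 2 - real k * \<omega>3))"
  proof (intro sum.cong refl sum_central_diff[where d = "d - \<omega>3 / 2"])
    show "x - \<omega>3 / 2 - real k * \<omega>3 - real N * \<omega>2 \<le> d - \<omega>3 / 2" for k
      using nn(3)[of k] Nw[OF omega_ge_1(2)] by linarith
  qed (rule D3)
  also have "\<dots> = H x"
    by (rule sum_central_diff[where d = d]) (use H Nw[OF omega_ge_1(3)] in auto)
  finally have sum_B: "(\<Sum>t\<in>B. triple_diff H (x - lattice_point t)) = H x" .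
  have outside: "triple_diff H (x - lattice_point t) = 0" if "t \<notin> B" for t
  proof -
    obtain i j k where t: "t = (i, j, k)" by (cases t)
    have ge: "real m * \<omega> \<ge> x - d" if "m \<ge> N" "\<omega> \<ge> 1" for m \<omega>
      using Nw[OF that(2)] that mult_right_mono[of "real N" "real m" \<omega>] by linarith
    have "i \<ge> N \<or> j \<ge> N \<or> k \<ge> N" using \<open>t \<notin> B\<close> by (auto simp: B_def t)
    then have "real i * \<omega>1 \<ge> x - d \<or> real j * \<omega>2 \<ge> x - d \<or> real k * \<omega>3 \<ge> x - d"
      using ge omega_ge_1 by blast
    \<comment> \<open>One large coordinate suffices, the others being nonnegative; then
      \<open>x - lattice_point t \<le> d - shift_a\<close>.\<close>
    then have "real i * \<omega>1 + real j * \<omega>2 + real k * \<omega>3 \<ge> x - d"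
      using nn(1)[of i] nn(2)[of j] nn(3)[of k] by linarith
    then show ?thesis
      by (intro triple_diff_eq_0_left[OF H]) (auto simp: t lattice_point_def)
  qed
  have "((\<lambda>t. triple_diff H (x - lattice_point t)) has_sum H x) B"
    unfolding sum_B[symmetric] by (rule has_sum_finite) (simp add: B_def)
  then have "((\<lambda>t. triple_diff H (x - lattice_point t)) has_sum H x) UNIV"
    by (rule has_sum_cong_neutral[THEN iffD1, rotated -1]) (use outside in auto)
  then show ?thesis
    unfolding Lambda1_eq has_sum_reindex[OF inj_lattice_point] by (simp add: o_def)
qed

lemma has_sum_triple_diff_Lambda:
  assumes H0: "\<And>y. y \<le> 0 \<Longrightarrow> H y = 0" and H1: "\<And>y. y \<ge> 1 \<Longrightarrow> H y = w"
  shows "((\<lambda>l. triple_diff H (x - l)) has_sum w) Lambda"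
proof -
  \<comment> \<open>The reflected function H(-y) - w vanishes for \<open>y \<le> -1\<close>, so the
    one-sided result applies to it at the point \<open>- x\<close>.\<close>
  have "((\<lambda>l. triple_diff (\<lambda>y. H (- y) - w) (- x - l)) has_sum (H (- (- x)) - w)) Lambda1"
    by (rule has_sum_triple_diff[where d = "-1"]) (simp add: H1)
  then have "((\<lambda>l. - triple_diff H (x + l)) has_sum (H x - w)) Lambda1"
    by (simp add: triple_diff_reflect add.commute)
  then have "((\<lambda>l. triple_diff H (x + l)) has_sum (w - H x)) Lambda1"
    by (simp add: has_sum_uminus)
  then have neg: "((\<lambda>l. triple_diff H (x - l)) has_sum (w - H x)) (uminus ` Lambda1)"
    by (subst has_sum_reindex) (auto simp: o_def)
  have "((\<lambda>l. triple_diff H (x - l)) has_sum (H x + (w - H x))) (Lambda1 \<union> uminus ` Lambda1)"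
    \<comment> \<open>The two halves are disjoint because \<open>Lambda1\<close> is
      positive.\<close>
    by (rule has_sum_Un_disjoint[OF has_sum_triple_diff[OF H0] neg])
       (auto dest!: Lambda1_pos)
  then show ?thesis by (simp add: Lambda_def)
qed

theorem theorem1p2:
  fixes w :: complex
  shows "\<exists>f \<in> schwartz_space. f \<noteq> (\<lambda>x. 0) \<and> compactly_supported f \<and>
           (\<forall>x::real. ((\<lambda>l. f (x - l)) has_sum w) Lambda)"
proof -
  obtain H x0 where sm: "smooth H" and nz: "H x0 \<noteq> 0"
    and H0: "\<And>x. x \<le> 0 \<Longrightarrow> H x = 0" and H1: "\<And>x. x \<ge> 1 \<Longrightarrow> H x = w"
    using exists_smooth_transition[of w] by metis
  have smf: "smooth (triple_diff H)"
    unfolding triple_diff_def by (intro smooth_central_diff sm)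
  have sup: "triple_diff H x = 0" if "\<bar>x\<bar> > 1 + shift_a" for x
  proof (cases "x < 0")
    case True
    with that show ?thesis by (intro triple_diff_eq_0_left[OF H0]) auto
  next
    case False
    \<comment> \<open>On the right the reflected function is used again: its vanishing threshold -1
      accounts for the 1 in \<open>1 + shift_a\<close>.\<close>
    with that have "triple_diff (\<lambda>y. H (- y) - w) (- x) = 0"
      by (intro triple_diff_eq_0_left[where d = "-1"]) (auto simp: H1)
    then show ?thesis by (simp add: triple_diff_reflect)
  qed
  have "triple_diff H \<noteq> (\<lambda>x. 0)"
  proof
    assume "triple_diff H = (\<lambda>x. 0)"
    \<comment> \<open>The sum over \<open>Lambda1\<close> alone recovers \<open>H\<close>, so a zero
      function would force \<open>H x0 = 0\<close>.\<close>
    then have "((\<lambda>l. 0) has_sum H x0) Lambda1"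
      using has_sum_triple_diff[of 0 H x0, OF H0] by simp
    moreover have "((\<lambda>l. 0::complex) has_sum 0) Lambda1" by simp
    ultimately show False using nz has_sum_unique by blast
  qed
  moreover have "((\<lambda>l. triple_diff H (x - l)) has_sum w) Lambda" for x
    by (rule has_sum_triple_diff_Lambda[OF H0 H1])
  ultimately show ?thesis
    using smooth_vanishing_outside_ball[OF smf sup] by blast
qed

end
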